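(* Let $d\ge1$, let $\Sigma$ be a symmetric positive-definite $d\times d$ real matrix, and let $f:(0,\infty)\to\mathbb{R}$ be convex, strictly convex at $1$, with $f(1)=0$. Then the $f$-divergences between any two densities of the multivariate location Cauchy family $\{p_{\mu,\Sigma}:\mu\in\mathbb{R}^d\}$ with prescribed matrix $\Sigma$ are symmetric: for all $\mu_1,\mu_2\in\mathbb{R}^d$, $$I_f(p_{\mu_1,\Sigma}:p_{\mu_2,\Sigma})=I_f(p_{\mu_2,\Sigma}:p_{\mu_1,\Sigma}).$$
   Context: The $d$-dimensional Cauchy density with parameters $\mu\in\mathbb{R}^d$ and $\Sigma\succ0$ is $p_{\mu,\Sigma}(x)=\frac{C_d}{(\det\Sigma)^{1/2}}\left(1+(x-\mu)^\top\Sigma^{-1}(x-\mu)\right)^{-(d+1)/2}$, $x\in\mathbb{R}^d$, with $C_d=\Gamma\!\left(\frac{d+1}{2}\right)\pi^{-\frac{d+1}{2}}$. The $f$-divergence is $I_f(p:q):=\int_{\mathbb{R}^d}p(x)f\!\left(\frac{q(x)}{p(x)}\right)dx$. *)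

theory Defs
  imports "HOL-Analysis.Analysis"
begin

definition positive_definite :: "real^'n^'n \<Rightarrow> bool" where
  "positive_definite A \<longleftrightarrow>
     transpose A = A \<and> (\<forall>x. x \<noteq> 0 \<longrightarrow> x \<bullet> (A *v x) > 0)"

definition cauchy_const :: "nat \<Rightarrow> real" where
  "cauchy_const d = Gamma ((real d + 1) / 2) * pi powr (- ((real d + 1) / 2))"

definition cauchy_density :: "real^'n \<Rightarrow> real^'n^'n \<Rightarrow> real^'n \<Rightarrow> real" where
  "cauchy_density \<mu> \<Sigma> x =
     cauchy_const CARD('n) / sqrt (det \<Sigma>) *
     (1 + (x - \<mu>) \<bullet> (matrix_inv \<Sigma> *v (x - \<mu>))) powr (- ((real CARD('n) + 1) / 2))"

text \<open>
  The integral is the Bochner integral, so its value is meaningful only if the integrand is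
  integrable. For two Cauchy densities \<open>p\<close>, \<open>q\<close> with the same matrix, \<open>q / p\<close> takes its values in
  a compact subinterval of \<open>(0, \<infinity>)\<close>, on which a convex \<open>f\<close> is continuous, hence bounded; so
  the integrand is always integrable in that case. The values of \<open>f\<close> outside \<open>(0, \<infinity>)\<close> are
  irrelevant for positive densities.
\<close>
definition f_divergence ::
    "(real \<Rightarrow> real) \<Rightarrow> ('a::euclidean_space \<Rightarrow> real) \<Rightarrow> ('a \<Rightarrow> real) \<Rightarrow> real" where
  "f_divergence f p q = (LINT x|lborel. p x * f (q x / p x))"

definition strictly_convex_at :: "real set \<Rightarrow> (real \<Rightarrow> real) \<Rightarrow> real \<Rightarrow> bool" where
  "strictly_convex_at S f a \<longleftrightarrow>
     (\<forall>x\<in>S. \<forall>y\<in>S. \<forall>t. x \<noteq> y \<longrightarrow> 0 < t \<longrightarrow> t < 1 \<longrightarrow> (1 - t) * x + t * y = a \<longrightarrow>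
        f a < (1 - t) * f x + t * f y)"

end

theory Submission
  imports Defs
begin

text \<open>
  The point reflection \<open>x \<mapsto> \<mu>\<^sub>1 + \<mu>\<^sub>2 - x\<close> preserves Lebesgue measure and, because each density
  is even about its location, exchanges the two densities.
\<close>

text \<open>An affine map of scale \<open>-1\<close> rescales volume by the factor
  \<open>\<bar>-1\<bar> ^ DIM('a) = 1\<close>.\<close>

lemma lborel_distr_reflect: "distr lborel borel (\<lambda>x. c - x) = (lborel :: 'a::euclidean_space measure)"
  using lborel_affine[of "-1" c] by (simp add: density_1)

text \<open>Allowing an arbitrary \<open>g\<close> spares its users a proof that the divergence
  integrand is measurable.\<close>

lemma lborel_integral_reflect:
  fixes g :: "'a::euclidean_space \<Rightarrow> real"
  shows "(LINT x|lborel. g (c - x)) = (LINT x|lborel. g x)"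
proof (cases "g \<in> borel_measurable borel")
  case True
  have "(LINT x|lborel. g x) = (LINT x|distr lborel borel (\<lambda>x. c - x). g x)"
    by (simp only: lborel_distr_reflect)
  also have "\<dots> = (LINT x|lborel. g (c - x))"
    using True by (intro integral_distr) auto
  finally show ?thesis ..
next
  case False
  \<comment> \<open>Reflecting twice is the identity, so measurability of the reflected function
    would pass back to \<open>g\<close>. Hence neither function is integrable, and both integrals
    take the default value 0.\<close>
  have "(\<lambda>x. g (c - x)) \<notin> borel_measurable borel"
  proof
    assume "(\<lambda>x. g (c - x)) \<in> borel_measurable borel"
    then have "(\<lambda>x. g (c - (c - x))) \<in> borel_measurable borel"
      by measurable
    with False show False by simp
  qed
  with False have "\<not> integrable lborel (\<lambda>x. g (c - x))" "\<not> integrable lborel g"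
    by (auto dest: borel_measurable_integrable)
  then show ?thesis
    by (simp add: not_integrable_integral_eq)
qed

text \<open>The common matrix \<open>\<Sigma>\<close> gives both densities the same normalizing
  factor and the same quadratic form, and that form ignores the sign of the displacement from the
  location.\<close>

lemma cauchy_density_reflect:
  "cauchy_density \<mu> \<Sigma> (\<mu> + \<nu> - x) = cauchy_density \<nu> \<Sigma> x"
proof -
  have even: "(- y) \<bullet> (A *v (- y)) = y \<bullet> (A *v y)" for A :: "real^'a^'a" and y
    by (simp add: linear_neg[OF matrix_vector_mul_linear])
  have "\<mu> + \<nu> - x - \<mu> = - (x - \<nu>)"
    by simp
  then show ?thesis
    unfolding cauchy_density_def by (simp only: even)
qed

theorem proposition7:
  fixes \<Sigma> :: "real^'n^'n" and f :: "real \<Rightarrow> real"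
  assumes "positive_definite \<Sigma>"
    and "convex_on {0<..} f"
    and "strictly_convex_at {0<..} f 1"
    and "f 1 = 0"
  shows "\<forall>\<mu>\<^sub>1 \<mu>\<^sub>2 :: real^'n.
    f_divergence f (cauchy_density \<mu>\<^sub>1 \<Sigma>) (cauchy_density \<mu>\<^sub>2 \<Sigma>) =
    f_divergence f (cauchy_density \<mu>\<^sub>2 \<Sigma>) (cauchy_density \<mu>\<^sub>1 \<Sigma>)"
proof (intro allI)
  fix \<mu>\<^sub>1 \<mu>\<^sub>2 :: "real^'n"
  let ?p = "cauchy_density \<mu>\<^sub>1 \<Sigma>" and ?q = "cauchy_density \<mu>\<^sub>2 \<Sigma>"
  have p: "?p (\<mu>\<^sub>1 + \<mu>\<^sub>2 - x) = ?q x" for x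
    by (rule cauchy_density_reflect)
  have q: "?q (\<mu>\<^sub>1 + \<mu>\<^sub>2 - x) = ?p x" for x
    using cauchy_density_reflect[of \<mu>\<^sub>2 \<Sigma> \<mu>\<^sub>1 x] by (simp add: add.commute)
  show "f_divergence f ?p ?q = f_divergence f ?q ?p"
    unfolding f_divergence_def
    \<comment> \<open>By \<open>p\<close> and \<open>q\<close>, reflecting this integrand swaps the
      two densities and yields the integrand of the reverse divergence.\<close>
    using lborel_integral_reflect[of "\<lambda>x. ?p x * f (?q x / ?p x)" "\<mu>\<^sub>1 + \<mu>\<^sub>2"]
    by (simp add: p q)
qed

end
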